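(* Let $B$ be a unital algebra over $\mathbb{C}$ generated (as a unital algebra) by one element. Then $\mathcal{T}_{Lie}(B)=\mathcal{N}_{Lie}(B)$.
   Context: For a unital associative algebra $B$, $B^{op}$ denotes the opposite algebra (same linear space, product $a*b=ba$), and $B\otimes B^{op}$ is the algebraic tensor product algebra. $\mathcal{T}_{Lie}(B)$ is the subalgebra (not required to contain the unit) of $B\otimes B^{op}$ generated by all elements $a\otimes 1-1\otimes a$, $a\in B$. $\mathcal{N}_{Lie}(B)$ is the subalgebra of $B\otimes B^{op}$ consisting of all tensors $\sum_k a_k\otimes b_k$ (finite sums) such that $\sum_k a_kb_k=0$ and $\sum_k b_ka_k=0$, the products being taken in $B$. *)

theory Defs
  imports Complex_Main "HOL-Library.Poly_Mapping"
begin

section \<open>Complex vector spaces and unital complex algebras\<close>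

class scaleC =
  fixes scaleC :: "complex \<Rightarrow> 'a \<Rightarrow> 'a" (infixr "*\<^sub>C" 75)

class complex_vector = scaleC + ab_group_add +
  assumes scaleC_add_right: "c *\<^sub>C (x + y) = c *\<^sub>C x + c *\<^sub>C y"
    and scaleC_add_left: "(c + d) *\<^sub>C x = c *\<^sub>C x + d *\<^sub>C x"
    and scaleC_scaleC: "c *\<^sub>C d *\<^sub>C x = (c * d) *\<^sub>C x"
    and scaleC_one: "1 *\<^sub>C x = x"

text \<open>The class \<^class>\<open>ring_1\<close> would exclude the zero algebra; \<^class>\<open>ring\<close> together with
  \<^class>\<open>monoid_mult\<close> does not.\<close>

class complex_algebra_1 = complex_vector + ring + monoid_mult +
  assumes scaleC_mult_left: "(c *\<^sub>C x) * y = c *\<^sub>C (x * y)"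
    and scaleC_mult_right: "x * (c *\<^sub>C y) = c *\<^sub>C (x * y)"

global_interpretation complex_vector: vector_space "scaleC :: complex \<Rightarrow> 'a \<Rightarrow> 'a::complex_vector"
  by unfold_locales
    (simp_all add: scaleC_add_right scaleC_add_left scaleC_scaleC scaleC_one)

abbreviation clinear :: "('a::complex_vector \<Rightarrow> 'b::complex_vector) \<Rightarrow> bool" where
  "clinear \<equiv> Vector_Spaces.linear scaleC scaleC"

lemma clinearI:
  assumes "\<And>x y. f (x + y) = f x + f y" "\<And>c x. f (c *\<^sub>C x) = c *\<^sub>C f x"
  shows "clinear f"
  using assms by unfold_locales

lemma clinear_add: "clinear f \<Longrightarrow> f (x + y) = f x + f y"
  by (simp add: Vector_Spaces.linear_iff)

lemma clinear_scale: "clinear f \<Longrightarrow> f (c *\<^sub>C x) = c *\<^sub>C f x"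
  by (simp add: Vector_Spaces.linear_iff)

lemma clinear_zero: "clinear f \<Longrightarrow> f 0 = 0"
  by (metis add_cancel_right_right clinear_add)

lemma clinear_diff: "clinear f \<Longrightarrow> f (x - y) = f x - f y"
  by (metis add_diff_cancel clinear_add diff_add_cancel)

lemma clinear_sum: "clinear f \<Longrightarrow> f (sum g A) = (\<Sum>a\<in>A. f (g a))"
  by (induction A rule: infinite_finite_induct) (simp_all add: clinear_zero clinear_add)

definition cbilinear ::
    "('a::complex_vector \<Rightarrow> 'b::complex_vector \<Rightarrow> 'c::complex_vector) \<Rightarrow> bool" where
  "cbilinear h \<longleftrightarrow> (\<forall>a. clinear (h a)) \<and> (\<forall>b. clinear (\<lambda>a. h a b))"

instantiation complex :: complex_algebra_1
begin
definition "scaleC c (z::complex) = c * z"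
instance by standard (simp_all add: scaleC_complex_def algebra_simps)
end


section \<open>Subalgebras\<close>

definition subalgebra :: "'a::complex_algebra_1 set \<Rightarrow> bool" where
  "subalgebra S \<longleftrightarrow> complex_vector.subspace S \<and> (\<forall>x\<in>S. \<forall>y\<in>S. x * y \<in> S)"

definition unital_subalgebra :: "'a::complex_algebra_1 set \<Rightarrow> bool" where
  "unital_subalgebra S \<longleftrightarrow> subalgebra S \<and> 1 \<in> S"

lemma subalgebra_hull: "subalgebra (subalgebra hull S)"
  by (rule hull_in) (auto simp: subalgebra_def intro: complex_vector.subspace_Inter)

lemma unital_subalgebra_hull: "unital_subalgebra (unital_subalgebra hull S)"
  by (rule hull_in)
    (auto simp: unital_subalgebra_def subalgebra_def intro: complex_vector.subspace_Inter)


section \<open>The opposite algebra\<close>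

datatype 'a opposite = Op (unop: 'a)

instantiation opposite :: (complex_algebra_1) complex_algebra_1
begin
definition "0 = Op 0"
definition "1 = Op 1"
definition "x + y = Op (unop x + unop y)"
definition "x - y = Op (unop x - unop y)"
definition "- x = Op (- unop x)"
definition "c *\<^sub>C x = Op (c *\<^sub>C unop x)"
definition times_opposite :: "'a opposite \<Rightarrow> 'a opposite \<Rightarrow> 'a opposite" where
  "x * y = Op (unop y * unop x)"
instance
  by standard
    (simp_all add: zero_opposite_def one_opposite_def plus_opposite_def minus_opposite_def
      uminus_opposite_def scaleC_opposite_def times_opposite_def algebra_simps
      scaleC_add_right scaleC_add_left scaleC_scaleC scaleC_one scaleC_mult_left scaleC_mult_right)
end

lemma Op_add: "Op (a + b) = Op a + Op b"
  by (simp add: plus_opposite_def)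

lemma Op_scaleC: "Op (c *\<^sub>C a) = c *\<^sub>C Op a"
  by (simp add: scaleC_opposite_def)

lemma Op_mult: "Op a * Op b = Op (b * a)"
  by (simp add: times_opposite_def)


section \<open>The algebraic tensor product of complex vector spaces\<close>

instantiation poly_mapping :: (type, complex_vector) complex_vector
begin
lift_definition scaleC_poly_mapping :: "complex \<Rightarrow> ('a \<Rightarrow>\<^sub>0 'b) \<Rightarrow> 'a \<Rightarrow>\<^sub>0 'b"
  is "\<lambda>c f x. c *\<^sub>C f x"
  by (erule rev_finite_subset) (auto simp: complex_vector.scale_zero_right)
instance
  by standard (transfer; simp add: fun_eq_iff scaleC_add_right scaleC_add_left scaleC_scaleC
      scaleC_one)+
end

text \<open>The tensor product is the free complex vector space on \<^typ>\<open>'a \<times> 'b\<close> (finitely supported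
  functions; \<^term>\<open>Poly_Mapping.single (a, b) 1\<close> is the basis vector belonging to \<^term>\<open>(a, b)\<close>)
  modulo the subspace spanned by the bilinearity relations. The convolution product that
  \<^theory>\<open>HOL-Library.Poly_Mapping\<close> puts on finitely supported functions is not used.\<close>

definition tensor_relators ::
    "(('a::complex_vector \<times> 'b::complex_vector) \<Rightarrow>\<^sub>0 complex) set" where
  "tensor_relators =
     {Poly_Mapping.single (a + a', b) 1 - Poly_Mapping.single (a, b) 1
        - Poly_Mapping.single (a', b) 1 | a a' b. True} \<union>
     {Poly_Mapping.single (a, b + b') 1 - Poly_Mapping.single (a, b) 1
        - Poly_Mapping.single (a, b') 1 | a b b'. True} \<union>
     {Poly_Mapping.single (c *\<^sub>C a, b) 1 - c *\<^sub>C Poly_Mapping.single (a, b) 1 | c a b. True} \<union>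
     {Poly_Mapping.single (a, c *\<^sub>C b) 1 - c *\<^sub>C Poly_Mapping.single (a, b) 1 | c a b. True}"

definition tensor_eq ::
    "(('a::complex_vector \<times> 'b::complex_vector) \<Rightarrow>\<^sub>0 complex) \<Rightarrow> ('a \<times> 'b \<Rightarrow>\<^sub>0 complex) \<Rightarrow> bool"
  where "tensor_eq f g \<longleftrightarrow> f - g \<in> complex_vector.span tensor_relators"

lemma equivp_tensor_eq: "equivp tensor_eq"
proof (rule equivpI)
  show "reflp tensor_eq"
    by (simp add: reflp_def tensor_eq_def complex_vector.span_zero)
  show "symp tensor_eq"
    unfolding symp_def tensor_eq_def by (metis complex_vector.span_neg minus_diff_eq)
  show "transp tensor_eq"
    unfolding transp_def tensor_eq_def using complex_vector.span_add by fastforce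
qed

quotient_type (overloaded) ('a, 'b) tensor =
    "('a::complex_vector \<times> 'b::complex_vector) \<Rightarrow>\<^sub>0 complex" / tensor_eq
  by (rule equivp_tensor_eq)

instantiation tensor :: (complex_vector, complex_vector) complex_vector
begin
lift_definition zero_tensor :: "('a, 'b) tensor" is 0 .
lift_definition plus_tensor :: "('a, 'b) tensor \<Rightarrow> ('a, 'b) tensor \<Rightarrow> ('a, 'b) tensor" is "(+)"
  unfolding tensor_eq_def add_diff_add by (rule complex_vector.span_add)
lift_definition minus_tensor :: "('a, 'b) tensor \<Rightarrow> ('a, 'b) tensor \<Rightarrow> ('a, 'b) tensor" is "(-)"
proof -
  fix f f' g g' :: "'a \<times> 'b \<Rightarrow>\<^sub>0 complex"
  assume "tensor_eq f f'" "tensor_eq g g'"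
  moreover have "(f - g) - (f' - g') = (f - f') - (g - g')"
    by (simp add: algebra_simps)
  ultimately show "tensor_eq (f - g) (f' - g')"
    unfolding tensor_eq_def by (simp only: complex_vector.span_diff)
qed
lift_definition uminus_tensor :: "('a, 'b) tensor \<Rightarrow> ('a, 'b) tensor" is uminus
proof -
  fix f f' :: "'a \<times> 'b \<Rightarrow>\<^sub>0 complex"
  assume "tensor_eq f f'"
  moreover have "- f - (- f') = - (f - f')" by simp
  ultimately show "tensor_eq (- f) (- f')"
    unfolding tensor_eq_def by (simp only: complex_vector.span_neg)
qed
lift_definition scaleC_tensor :: "complex \<Rightarrow> ('a, 'b) tensor \<Rightarrow> ('a, 'b) tensor" is scaleC
  unfolding tensor_eq_def complex_vector.scale_right_diff_distrib[symmetric]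
  by (rule complex_vector.span_scale)
instance
  by standard
    (transfer; simp add: tensor_eq_def algebra_simps complex_vector.span_zero
      scaleC_add_right scaleC_add_left scaleC_scaleC scaleC_one)+
end

lift_definition tensor_pure :: "'a::complex_vector \<Rightarrow> 'b::complex_vector \<Rightarrow> ('a, 'b) tensor"
    (infixl "\<otimes>" 75)
  is "\<lambda>a b. Poly_Mapping.single (a, b) 1" .

lemma tensor_pure_add_left: "(a + a') \<otimes> b = a \<otimes> b + a' \<otimes> b"
  by transfer (unfold tensor_eq_def diff_diff_eq[symmetric],
      rule complex_vector.span_base, unfold tensor_relators_def, blast)

lemma tensor_pure_add_right: "a \<otimes> (b + b') = a \<otimes> b + a \<otimes> b'"
  by transfer (unfold tensor_eq_def diff_diff_eq[symmetric],
      rule complex_vector.span_base, unfold tensor_relators_def, blast)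

lemma tensor_pure_scaleC_left: "(c *\<^sub>C a) \<otimes> b = c *\<^sub>C (a \<otimes> b)"
  by transfer (unfold tensor_eq_def,
      rule complex_vector.span_base, unfold tensor_relators_def, blast)

lemma tensor_pure_scaleC_right: "a \<otimes> (c *\<^sub>C b) = c *\<^sub>C (a \<otimes> b)"
  by transfer (unfold tensor_eq_def,
      rule complex_vector.span_base, unfold tensor_relators_def, blast)

lemma cbilinear_tensor_pure: "cbilinear (\<otimes>)"
  by (simp add: cbilinear_def clinearI tensor_pure_add_left tensor_pure_add_right
      tensor_pure_scaleC_left tensor_pure_scaleC_right)


subsection \<open>Universal property\<close>

definition free_extend :: "('i \<Rightarrow> 'v::complex_vector) \<Rightarrow> ('i \<Rightarrow>\<^sub>0 complex) \<Rightarrow> 'v" where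
  "free_extend h f = (\<Sum>i\<in>Poly_Mapping.keys f. Poly_Mapping.lookup f i *\<^sub>C h i)"

lemma free_extend_superset:
  assumes "finite A" "Poly_Mapping.keys f \<subseteq> A"
  shows "free_extend h f = (\<Sum>i\<in>A. Poly_Mapping.lookup f i *\<^sub>C h i)"
  unfolding free_extend_def
  by (rule sum.mono_neutral_left) (use assms in \<open>auto simp: in_keys_iff\<close>)

lemma clinear_free_extend: "clinear (free_extend h)"
proof (rule clinearI)
  fix f g :: "'a \<Rightarrow>\<^sub>0 complex" and c :: complex
  let ?A = "Poly_Mapping.keys f \<union> Poly_Mapping.keys g"
  have "Poly_Mapping.keys (f + g) \<subseteq> ?A" by (rule Poly_Mapping.keys_add)
  then show "free_extend h (f + g) = free_extend h f + free_extend h g"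
    by (simp add: free_extend_superset[of ?A] lookup_add scaleC_add_left sum.distrib)
  have "Poly_Mapping.keys (c *\<^sub>C f) \<subseteq> Poly_Mapping.keys f"
    by (auto simp: in_keys_iff scaleC_poly_mapping.rep_eq complex_vector.scale_zero_right)
  then show "free_extend h (c *\<^sub>C f) = c *\<^sub>C free_extend h f"
    by (simp add: free_extend_superset[of "Poly_Mapping.keys f"] scaleC_poly_mapping.rep_eq
        complex_vector.scale_sum_right scaleC_scaleC scaleC_complex_def)
qed

lemma free_extend_single: "free_extend h (Poly_Mapping.single i 1) = h i"
  by (simp add: free_extend_def scaleC_one)

lemma free_extend_tensor_eq:
  assumes h: "cbilinear h" and "tensor_eq f g"
  shows "free_extend (\<lambda>(a, b). h a b) f = free_extend (\<lambda>(a, b). h a b) g"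
proof -
  let ?F = "free_extend (\<lambda>(a, b). h a b)"
  have lin: "clinear (h a)" "clinear (\<lambda>a. h a b)" for a b
    using h by (auto simp: cbilinear_def)
  have "complex_vector.span tensor_relators \<subseteq> {f. ?F f = 0}"
  proof (rule complex_vector.span_minimal)
    show "tensor_relators \<subseteq> {f. ?F f = 0}"
      by (auto simp: tensor_relators_def clinear_diff[OF clinear_free_extend]
          clinear_scale[OF clinear_free_extend] free_extend_single
          clinear_add[OF lin(1)] clinear_add[OF lin(2)]
          clinear_scale[OF lin(1)] clinear_scale[OF lin(2)])
    show "complex_vector.subspace {f. ?F f = 0}"
      by (simp add: complex_vector.subspace_def clinear_zero[OF clinear_free_extend]
          clinear_add[OF clinear_free_extend] clinear_scale[OF clinear_free_extend]
          complex_vector.scale_zero_right)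
  qed
  then show ?thesis
    using \<open>tensor_eq f g\<close> by (auto simp: tensor_eq_def clinear_diff[OF clinear_free_extend])
qed

text \<open>The linear map on the tensor product that a bilinear map \<^term>\<open>h\<close> induces; unspecified
  when \<^term>\<open>h\<close> is not bilinear.\<close>

definition tensor_lift ::
    "('a::complex_vector \<Rightarrow> 'b::complex_vector \<Rightarrow> 'v::complex_vector) \<Rightarrow> ('a, 'b) tensor \<Rightarrow> 'v"
  where "tensor_lift h t = free_extend (\<lambda>(a, b). h a b) (rep_tensor t)"

lemma tensor_lift_abs:
  assumes "cbilinear h"
  shows "tensor_lift h (abs_tensor f) = free_extend (\<lambda>(a, b). h a b) f"
  unfolding tensor_lift_def
  by (rule free_extend_tensor_eq[OF assms])
    (metis Quotient3_rep_abs Quotient3_tensor equivp_reflp equivp_tensor_eq)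

lemma tensor_lift_pure: "cbilinear h \<Longrightarrow> tensor_lift h (a \<otimes> b) = h a b"
  by (simp add: tensor_pure.abs_eq tensor_lift_abs free_extend_single)

lemma clinear_tensor_lift:
  assumes "cbilinear h" shows "clinear (tensor_lift h)"
proof (rule clinearI)
  show "tensor_lift h (s + t) = tensor_lift h s + tensor_lift h t" for s t
    by (induct s, induct t)
      (simp add: plus_tensor.abs_eq tensor_lift_abs[OF assms] clinear_add[OF clinear_free_extend])
  show "tensor_lift h (c *\<^sub>C t) = c *\<^sub>C tensor_lift h t" for c t
    by (induct t)
      (simp add: scaleC_tensor.abs_eq tensor_lift_abs[OF assms]
        clinear_scale[OF clinear_free_extend])
qed

lemma tensor_eq_sum: "\<exists>n a b. t = (\<Sum>k<n::nat. a k \<otimes> b k)"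
proof (induct t)
  fix f :: "'a \<times> 'b \<Rightarrow>\<^sub>0 complex"
  let ?P = "\<lambda>t::('a, 'b) tensor. \<exists>n a b. t = (\<Sum>k<n::nat. a k \<otimes> b k)"
  show "?P (abs_tensor f)"
  proof (induct f rule: update_induct)
    case const
    show ?case
      by (rule exI[of _ 0]) (simp add: zero_tensor_def)
  next
    case (update f p c)
    obtain a' b' where p: "p = (a', b')" by (cases p)
    have "Poly_Mapping.update p c f = f + c *\<^sub>C Poly_Mapping.single p 1"
      using update(1) by (intro poly_mapping_eqI)
        (auto simp: scaleC_poly_mapping.rep_eq lookup_single Poly_Mapping.lookup_update lookup_add
          scaleC_complex_def when_def in_keys_iff)
    then have upd: "abs_tensor (Poly_Mapping.update p c f) = abs_tensor f + (c *\<^sub>C a') \<otimes> b'"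
      unfolding p tensor_pure_scaleC_left
      by (simp add: tensor_pure.abs_eq scaleC_tensor.abs_eq plus_tensor.abs_eq)
    obtain n a b where f: "abs_tensor f = (\<Sum>k<n::nat. a k \<otimes> b k)"
      using update(3) by blast
    have "abs_tensor (Poly_Mapping.update p c f)
        = (\<Sum>k<Suc n. (a(n := c *\<^sub>C a')) k \<otimes> (b(n := b')) k)"
      by (simp add: upd f)
    then show ?case by blast
  qed
qed

lemma tensor_induct [case_names pure add]:
  assumes pure: "\<And>a b. P (a \<otimes> b)" and add: "\<And>s t. P s \<Longrightarrow> P t \<Longrightarrow> P (s + t)"
  shows "P t"
proof -
  have zero: "P 0"
    using pure[of 0 0] by (metis tensor_pure_scaleC_left complex_vector.scale_zero_left)
  obtain n a b where t: "t = (\<Sum>k<n::nat. a k \<otimes> b k)" using tensor_eq_sum by blast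
  show ?thesis unfolding t by (induction n) (simp_all add: zero pure add)
qed


section \<open>The tensor product of unital complex algebras\<close>

instantiation tensor :: (complex_algebra_1, complex_algebra_1) complex_algebra_1
begin

definition one_tensor :: "('a, 'b) tensor" where
  "1 = 1 \<otimes> 1"

definition times_tensor :: "('a, 'b) tensor \<Rightarrow> ('a, 'b) tensor \<Rightarrow> ('a, 'b) tensor" where
  "s * t = tensor_lift (\<lambda>a b. tensor_lift (\<lambda>c d. (a * c) \<otimes> (b * d)) t) s"

context
begin

private lemma inner: "cbilinear (\<lambda>c d. (a * c) \<otimes> (b * d) :: ('a, 'b) tensor)"
  by (simp add: cbilinear_def clinearI distrib_left scaleC_mult_right tensor_pure_add_left
      tensor_pure_add_right tensor_pure_scaleC_left tensor_pure_scaleC_right)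

private lemma inner_pure:
  "tensor_lift (\<lambda>c d. (a * c) \<otimes> (b * d)) (c \<otimes> d) = ((a * c) \<otimes> (b * d) :: ('a, 'b) tensor)"
  by (simp add: tensor_lift_pure[OF inner])

private lemma inner_add:
  "tensor_lift (\<lambda>c d. (a * c) \<otimes> (b * d)) (s + t) =
   tensor_lift (\<lambda>c d. (a * c) \<otimes> (b * d)) s + (tensor_lift (\<lambda>c d. (a * c) \<otimes> (b * d)) t :: ('a, 'b) tensor)"
  by (simp add: clinear_add[OF clinear_tensor_lift[OF inner]])

private lemma outer: "cbilinear (\<lambda>a b. tensor_lift (\<lambda>c d. (a * c) \<otimes> (b * d) :: ('a, 'b) tensor) t)"
proof (induct t rule: tensor_induct)
  case (pure c d)
  then show ?case
    by (simp add: inner_pure cbilinear_def clinearI distrib_right scaleC_mult_left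
        tensor_pure_add_left tensor_pure_add_right tensor_pure_scaleC_left tensor_pure_scaleC_right)
next
  case (add s t)
  then show ?case
    by (auto simp: inner_add cbilinear_def Vector_Spaces.linear_iff scaleC_add_right
        complex_vector.vector_space_axioms)
qed

private lemma pure_mult:
  "(a \<otimes> b) * t = (tensor_lift (\<lambda>c d. (a * c) \<otimes> (b * d)) t :: ('a, 'b) tensor)"
  unfolding times_tensor_def by (rule tensor_lift_pure[OF outer])

lemma tensor_mult_pure: "(a \<otimes> b) * (c \<otimes> d) = ((a * c) \<otimes> (b * d) :: ('a, 'b) tensor)"
  by (simp add: pure_mult inner_pure)

private lemma mult_add_left: "(r + s) * t = r * t + (s * t :: ('a, 'b) tensor)"
  by (simp add: times_tensor_def clinear_add[OF clinear_tensor_lift[OF outer]])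

private lemma mult_scaleC_left: "(c *\<^sub>C s) * t = c *\<^sub>C (s * t :: ('a, 'b) tensor)"
  by (simp add: times_tensor_def clinear_scale[OF clinear_tensor_lift[OF outer]])

private lemma mult_add_right: "r * (s + t) = r * s + (r * t :: ('a, 'b) tensor)"
proof (induct r rule: tensor_induct)
  case (pure a b)
  then show ?case
    by (simp add: pure_mult inner_add)
qed (simp add: mult_add_left algebra_simps)

private lemma mult_scaleC_right: "s * (c *\<^sub>C t) = c *\<^sub>C (s * t :: ('a, 'b) tensor)"
proof (induct s rule: tensor_induct)
  case (pure a b)
  then show ?case
    by (simp add: pure_mult
        clinear_scale[OF clinear_tensor_lift[OF inner]])
qed (simp add: mult_add_left scaleC_add_right)

private lemma tensor_mult_assoc: "(r * s) * t = r * (s * t :: ('a, 'b) tensor)"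
proof (induct r rule: tensor_induct)
  case (pure a b)
  show ?case
  proof (induct s rule: tensor_induct)
    case (pure c d)
    show ?case
      by (induct t rule: tensor_induct) (simp_all add: tensor_mult_pure mult_add_right mult.assoc)
  qed (simp add: mult_add_left mult_add_right)
qed (simp add: mult_add_left)

instance
proof
  fix r s t :: "('a, 'b) tensor" and c :: complex
  show "1 * t = t"
    by (induct t rule: tensor_induct) (simp_all add: one_tensor_def tensor_mult_pure mult_add_right)
  show "t * 1 = t"
    by (induct t rule: tensor_induct) (simp_all add: one_tensor_def tensor_mult_pure mult_add_left)
qed (fact mult_add_left mult_add_right mult_scaleC_left mult_scaleC_right tensor_mult_assoc)+

end

end


section \<open>The algebras \<open>T\<^sub>L\<^sub>i\<^sub>e(B)\<close> and \<open>N\<^sub>L\<^sub>i\<^sub>e(B)\<close>\<close>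

definition T_Lie :: "('a::complex_algebra_1, 'a opposite) tensor set" where
  "T_Lie = subalgebra hull {a \<otimes> Op 1 - 1 \<otimes> Op a | a. True}"

definition N_Lie :: "('a::complex_algebra_1, 'a opposite) tensor set" where
  "N_Lie = {\<Sum>k<n. a k \<otimes> Op (b k) | (n::nat) a b.
              (\<Sum>k<n. a k * b k) = 0 \<and> (\<Sum>k<n. b k * a k) = 0}"

text \<open>Both sums in the definition of \<^const>\<open>N_Lie\<close> depend on the tensor only.\<close>

lemma cbilinear_mult: "cbilinear (\<lambda>(a::'a::complex_algebra_1) b. a * unop b)"
  by (simp add: cbilinear_def clinearI plus_opposite_def scaleC_opposite_def distrib_left
      distrib_right scaleC_mult_left scaleC_mult_right)

lemma cbilinear_mult_swap: "cbilinear (\<lambda>(a::'a::complex_algebra_1) b. unop b * a)"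
  by (simp add: cbilinear_def clinearI plus_opposite_def scaleC_opposite_def distrib_left
      distrib_right scaleC_mult_left scaleC_mult_right)

lemma N_Lie_iff:
  "t \<in> N_Lie \<longleftrightarrow> tensor_lift (\<lambda>a b. a * unop b) t = 0 \<and> tensor_lift (\<lambda>a b. unop b * a) t = 0"
proof -
  have *: "tensor_lift (\<lambda>a b. a * unop b) (\<Sum>k<n::nat. a k \<otimes> Op (b k)) = (\<Sum>k<n. a k * b k)"
    "tensor_lift (\<lambda>a b. unop b * a) (\<Sum>k<n::nat. a k \<otimes> Op (b k)) = (\<Sum>k<n. b k * a k)"
    for n and a b :: "nat \<Rightarrow> 'a"
    by (simp_all add: clinear_sum clinear_tensor_lift cbilinear_mult cbilinear_mult_swap
        tensor_lift_pure)
  obtain n a b where t: "t = (\<Sum>k<n::nat. a k \<otimes> b k)" using tensor_eq_sum by blast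
  then have t': "t = (\<Sum>k<n. a k \<otimes> Op (unop (b k)))" by simp
  show ?thesis
  proof
    assume "t \<in> N_Lie"
    then show "tensor_lift (\<lambda>a b. a * unop b) t = 0 \<and> tensor_lift (\<lambda>a b. unop b * a) t = 0"
      unfolding N_Lie_def using * by fastforce
  next
    assume "tensor_lift (\<lambda>a b. a * unop b) t = 0 \<and> tensor_lift (\<lambda>a b. unop b * a) t = 0"
    then have "(\<Sum>k<n. a k * unop (b k)) = 0 \<and> (\<Sum>k<n. unop (b k) * a k) = 0"
      unfolding t' * .
    then show "t \<in> N_Lie"
      unfolding N_Lie_def using t' by (intro CollectI exI conjI) auto
  qed
qed

lemma subalgebra_N_Lie: "subalgebra (N_Lie :: ('a::complex_algebra_1, 'a opposite) tensor set)"
proof -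
  let ?m = "tensor_lift (\<lambda>(a::'a) b. a * unop b)"
  let ?m' = "tensor_lift (\<lambda>(a::'a) b. unop b * a)"
  note lin = clinear_tensor_lift[OF cbilinear_mult] clinear_tensor_lift[OF cbilinear_mult_swap]
  note add = lin[THEN clinear_add]
  note pure = tensor_lift_pure[OF cbilinear_mult] tensor_lift_pure[OF cbilinear_mult_swap]
  have m_pure: "?m ((a \<otimes> b) * t) = a * ?m t * unop b" for a b t
    by (induct t rule: tensor_induct)
      (simp_all add: tensor_mult_pure pure add distrib_left distrib_right times_opposite_def
        mult.assoc)
  have m'_pure: "?m' (s * (a \<otimes> b)) = unop b * ?m' s * a" for a b s
    by (induct s rule: tensor_induct)
      (simp_all add: tensor_mult_pure pure add distrib_left distrib_right times_opposite_def
        mult.assoc)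
  have "?m (s * t) = 0" if "?m t = 0" for s t
    by (induct s rule: tensor_induct) (simp_all add: that m_pure add distrib_right)
  moreover have "?m' (s * t) = 0" if "?m' s = 0" for s t
    by (induct t rule: tensor_induct) (simp_all add: that m'_pure add distrib_left)
  ultimately show ?thesis
    by (simp add: subalgebra_def complex_vector.subspace_def N_Lie_iff add
        lin[THEN clinear_zero] lin[THEN clinear_scale] complex_vector.scale_zero_right)
qed

end

theory Submission
  imports Defs
begin

text \<open>Write \<open>M i j = x\<^sup>i \<otimes> x\<^sup>j\<close>, \<open>u = M 1 0 - M 0 1\<close> and \<open>D i j = u * M i j = M (i + 1) j - M i (j + 1)\<close>.
  All \<open>D i j\<close> lie in \<open>T\<^sub>L\<^sub>i\<^sub>e(B)\<close>, by induction on \<open>n = i + j\<close>: multiplying elements of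
  degree \<open>n - 1\<close> by \<open>u\<close> shows that the elements \<open>D i j\<close> of degree \<open>n\<close> are congruent modulo
  \<open>T\<^sub>L\<^sub>i\<^sub>e(B)\<close>; their sum telescopes to \<open>x\<^sup>n\<^sup>+\<^sup>1 \<otimes> 1 - 1 \<otimes> x\<^sup>n\<^sup>+\<^sup>1\<close>, which is a generator, and one
  divides by \<open>n + 1\<close>. Hence \<open>a \<otimes> b\<close> is congruent to \<open>ab \<otimes> 1\<close> for powers \<open>a\<close>, \<open>b\<close> of \<open>x\<close>, so for
  all \<open>a\<close>, \<open>b\<close> by bilinearity, and \<open>\<Sum> a\<^sub>k \<otimes> b\<^sub>k\<close> is congruent to \<open>(\<Sum> a\<^sub>k b\<^sub>k) \<otimes> 1\<close>.\<close>

text \<open>Powers multiply to powers, so their span is closed under products, first with a power as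
  left factor and then, by linearity, with any left factor. It contains \<open>1\<close> and
  \<open>x\<close>, hence the whole hull.\<close>

lemma span_powers_eq_UNIV:
  fixes x :: "'a::complex_algebra_1"
  assumes "unital_subalgebra hull {x} = UNIV"
  shows "complex_vector.span (range (\<lambda>n::nat. x ^ n)) = UNIV"
proof -
  let ?S = "complex_vector.span (range (\<lambda>n::nat. x ^ n))"
  have power_mult: "x ^ n * b \<in> ?S" if "b \<in> ?S" for n b
    using that
  proof (induct rule: complex_vector.span_induct_alt)
    case base
    then show ?case by (simp add: complex_vector.span_zero)
  next
    case (step c y z)
    then obtain m where "y = x ^ m" by auto
    then have "x ^ n * y \<in> ?S"
      by (auto simp flip: power_add intro: complex_vector.span_base)
    with step show ?case
      by (simp add: distrib_left scaleC_mult_right complex_vector.span_add complex_vector.span_scale)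
  qed
  have mult: "a * b \<in> ?S" if "a \<in> ?S" "b \<in> ?S" for a b
    using that(1)
  proof (induct rule: complex_vector.span_induct_alt)
    case base
    then show ?case by (simp add: complex_vector.span_zero)
  next
    case (step c y z)
    with power_mult[OF that(2)] show ?case
      by (auto simp: distrib_right scaleC_mult_left
          intro!: complex_vector.span_add complex_vector.span_scale)
  qed
  have "x ^ 0 \<in> ?S" "x ^ 1 \<in> ?S"
    by (rule complex_vector.span_base, blast)+
  with mult have "{x} \<subseteq> ?S" "unital_subalgebra ?S"
    by (auto simp: unital_subalgebra_def subalgebra_def complex_vector.subspace_span)
  then have "unital_subalgebra hull {x} \<subseteq> ?S"
    by (rule hull_minimal)
  with assms show ?thesis by auto
qed

text \<open>Both multiplication maps send each generator to \<open>a - a = 0\<close>, and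
  \<open>N_Lie\<close> is a subalgebra.\<close>

lemma T_Lie_subset_N_Lie: "(T_Lie :: ('a::complex_algebra_1, 'a opposite) tensor set) \<subseteq> N_Lie"
  unfolding T_Lie_def
proof (rule hull_minimal)
  show "{a \<otimes> Op 1 - 1 \<otimes> Op a | a::'a. True} \<subseteq> N_Lie"
    by (auto simp: N_Lie_iff clinear_diff clinear_tensor_lift cbilinear_mult cbilinear_mult_swap
        tensor_lift_pure)
qed (rule subalgebra_N_Lie)

lemma subspace_T_Lie: "complex_vector.subspace T_Lie"
  and T_Lie_mult: "s \<in> T_Lie \<Longrightarrow> t \<in> T_Lie \<Longrightarrow> s * t \<in> T_Lie"
  using subalgebra_hull unfolding T_Lie_def subalgebra_def by blast+

lemma T_Lie_generator: "a \<otimes> Op 1 - 1 \<otimes> Op a \<in> T_Lie"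
  unfolding T_Lie_def by (rule hull_inc) blast

text \<open>Modulo \<open>V\<close> every \<open>f i\<close> equals \<open>f 0\<close>, so the sum
  is congruent to \<open>(n + 1) f 0\<close>, and \<open>n + 1\<close> is invertible in the complex
  numbers.\<close>

lemma all_mem_subspace_if_sum_mem:
  fixes f :: "nat \<Rightarrow> 'a::complex_vector"
  assumes "complex_vector.subspace V"
    and step: "\<And>i. i < n \<Longrightarrow> f (Suc i) - f i \<in> V"
    and sum: "(\<Sum>i\<le>n. f i) \<in> V"
    and "i \<le> n"
  shows "f i \<in> V"
proof -
  note V = assms(1)
  have diff: "f i - f 0 \<in> V" if "i \<le> n" for i
    using that
  proof (induct i)
    case 0
    then show ?case by (simp add: V complex_vector.subspace_0)
  next
    case (Suc i)
    then show ?case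
      using complex_vector.subspace_add[OF V step[of i], of "f i - f 0"] by simp
  qed
  have "(\<Sum>i\<le>n. f i) - (\<Sum>i\<le>n. f i - f 0) = of_nat (Suc n) *\<^sub>C f 0"
    by (simp add: sum_subtractf complex_vector.sum_constant_scale del: of_nat_Suc)
  moreover have "(\<Sum>i\<le>n. f i) - (\<Sum>i\<le>n. f i - f 0) \<in> V"
    by (rule complex_vector.subspace_diff[OF V sum complex_vector.subspace_sum[OF V]])
      (simp add: diff)
  ultimately have "inverse (of_nat (Suc n)) *\<^sub>C of_nat (Suc n) *\<^sub>C f 0 \<in> V"
    using complex_vector.subspace_scale[OF V] by metis
  then have "f 0 \<in> V"
    by (simp add: scaleC_scaleC scaleC_one del: of_nat_Suc)
  then show ?thesis
    using complex_vector.subspace_add[OF V diff[OF \<open>i \<le> n\<close>]] by fastforce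
qed

lemma T_Lie_power_step:
  fixes x :: "'a::complex_algebra_1"
  assumes "i \<le> n"
  shows "x ^ Suc i \<otimes> Op (x ^ (n - i)) - x ^ i \<otimes> Op (x ^ Suc (n - i)) \<in> T_Lie"
  using assms
proof (induct n arbitrary: i)
  case 0
  then show ?case using T_Lie_generator[of x] by simp
next
  case (Suc n)
  let ?M = "\<lambda>i j. x ^ i \<otimes> Op (x ^ j)"
  let ?u = "x \<otimes> Op 1 - 1 \<otimes> Op x"
  let ?D = "\<lambda>i. ?M (Suc i) (Suc n - i) - ?M i (Suc (Suc n - i))"
  \<comment> \<open>The reversed product in the second factor is harmless, since powers of
    \<open>x\<close> commute.\<close>
  have u: "?u * ?M i j = ?M (Suc i) j - ?M i (Suc j)" for i j
    by (simp add: left_diff_distrib tensor_mult_pure Op_mult power_commutes)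
  show ?case
  proof (rule all_mem_subspace_if_sum_mem[OF subspace_T_Lie _ _ Suc.prems])
    fix i assume "i < Suc n"
    \<comment> \<open>Expanding this product by \<open>u\<close> gives exactly
      \<open>?D (Suc i) - ?D i\<close>.\<close>
    then have "?u * (?M (Suc i) (n - i) - ?M i (Suc (n - i))) \<in> T_Lie"
      by (intro T_Lie_mult T_Lie_generator Suc.hyps) simp
    with \<open>i < Suc n\<close> show "?D (Suc i) - ?D i \<in> T_Lie"
      unfolding right_diff_distrib u by (simp add: Suc_diff_le del: power_Suc)
  next
    \<comment> \<open>The exponents are rewritten so that each summand is
      \<open>g (Suc i) - g i\<close> with \<open>g i = ?M i (n + 2 - i)\<close>; this needs
      \<open>i \<le> n + 1\<close> because subtraction is truncated.\<close>
    have "(\<Sum>i\<le>Suc n. ?D i) = (\<Sum>i\<le>Suc n. ?M (Suc i) (Suc (Suc n) - Suc i) - ?M i (Suc (Suc n) - i))"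
      by (rule sum.cong) (simp_all add: Suc_diff_le del: power_Suc)
    also have "\<dots> = ?M (Suc (Suc n)) 0 - ?M 0 (Suc (Suc n))"
      unfolding lessThan_Suc_atMost[symmetric]
      by (subst sum_lessThan_telescope) (simp del: power_Suc)
    also have "\<dots> \<in> T_Lie"
      using T_Lie_generator[of "x ^ Suc (Suc n)"] by (simp del: power_Suc)
    finally show "(\<Sum>i\<le>Suc n. ?D i) \<in> T_Lie" .
  qed
qed

text \<open>Each induction step moves one factor \<open>x\<close> from the right leg to the left, so
  \<open>i\<close> must be arbitrary.\<close>

lemma T_Lie_power_pure:
  "x ^ i \<otimes> Op (x ^ j) - (x ^ i * x ^ j) \<otimes> Op 1 \<in> T_Lie"
proof (induct j arbitrary: i)
  case 0
  then show ?case by (simp add: complex_vector.subspace_0[OF subspace_T_Lie])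
next
  case (Suc j)
  have "x ^ Suc i \<otimes> Op (x ^ j) - x ^ i \<otimes> Op (x ^ Suc j) \<in> T_Lie"
    using T_Lie_power_step[of i "i + j" x] by simp
  from complex_vector.subspace_diff[OF subspace_T_Lie Suc[of "Suc i"] this]
  show ?case by (simp flip: power_add del: power_Suc)
qed

text \<open>The difference is linear in \<open>a\<close> and in \<open>b\<close>, which reduces the
  claim to powers of \<open>x\<close>.\<close>

lemma T_Lie_pure:
  fixes x a b :: "'a::complex_algebra_1"
  assumes "unital_subalgebra hull {x} = UNIV"
  shows "a \<otimes> Op b - (a * b) \<otimes> Op 1 \<in> T_Lie"
proof -
  let ?g = "\<lambda>a b :: 'a. a \<otimes> Op b - (a * b) \<otimes> Op 1"
  note span = span_powers_eq_UNIV[OF assms]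
  note V = complex_vector.subspace_0[OF subspace_T_Lie] complex_vector.subspace_add[OF subspace_T_Lie]
    complex_vector.subspace_scale[OF subspace_T_Lie]
  have left: "clinear (\<lambda>a. ?g a b)" for b :: 'a
    by (rule clinearI) (simp_all add: tensor_pure_add_left tensor_pure_scaleC_left distrib_right
        scaleC_mult_left complex_vector.scale_right_diff_distrib)
  have right: "clinear (?g a)" for a :: 'a
    by (rule clinearI) (simp_all add: tensor_pure_add_left tensor_pure_scaleC_left Op_add Op_scaleC
        tensor_pure_add_right tensor_pure_scaleC_right distrib_left scaleC_mult_right
        complex_vector.scale_right_diff_distrib)
  have power: "?g (x ^ i) b \<in> T_Lie" for i
  proof -
    have "b \<in> complex_vector.span (range (\<lambda>n::nat. x ^ n))" by (simp add: span)
    then show ?thesis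
    proof (induct rule: complex_vector.span_induct_alt)
      case base
      then show ?case by (simp only: clinear_zero[OF right] V)
    next
      case (step c y z)
      then show ?case
        using T_Lie_power_pure[of x i]
        by (auto simp only: clinear_add[OF right] clinear_scale[OF right] intro!: V)
    qed
  qed
  have "a \<in> complex_vector.span (range (\<lambda>n::nat. x ^ n))" by (simp add: span)
  then show ?thesis
  proof (induct rule: complex_vector.span_induct_alt)
    case base
    then show ?case by (simp only: clinear_zero[OF left] V)
  next
    case (step c y z)
    then show ?case
      using power by (auto simp only: clinear_add[OF left] clinear_scale[OF left] intro!: V)
  qed
qed

theorem theorem2p3:
  assumes "\<exists>x :: 'a::complex_algebra_1. unital_subalgebra hull {x} = UNIV"
  shows "(T_Lie :: ('a, 'a opposite) tensor set) = N_Lie"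
proof
  show "(T_Lie :: ('a, 'a opposite) tensor set) \<subseteq> N_Lie" by (rule T_Lie_subset_N_Lie)
  obtain x :: 'a where x: "unital_subalgebra hull {x} = UNIV"
    using assms by blast
  show "(N_Lie :: ('a, 'a opposite) tensor set) \<subseteq> T_Lie"
  proof
    fix t :: "('a, 'a opposite) tensor"
    assume "t \<in> N_Lie"
    then obtain n and a b :: "nat \<Rightarrow> 'a"
      where t: "t = (\<Sum>k<n. a k \<otimes> Op (b k))" and zero: "(\<Sum>k<n. a k * b k) = 0"
      unfolding N_Lie_def by blast
    have lin: "clinear (\<lambda>a::'a. a \<otimes> Op (1::'a))"
      by (rule clinearI) (simp_all add: tensor_pure_add_left tensor_pure_scaleC_left)
    have "(\<Sum>k<n. (a k * b k) \<otimes> Op (1::'a)) = 0"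
      using clinear_sum[OF lin, of "\<lambda>k. a k * b k" "{..<n}"] clinear_zero[OF lin] zero by simp
    \<comment> \<open>Subtracting a zero sum puts each summand separately into
      \<open>T_Lie\<close>.\<close>
    then have "t = (\<Sum>k<n. a k \<otimes> Op (b k) - (a k * b k) \<otimes> Op 1)"
      by (simp add: t sum_subtractf)
    also have "\<dots> \<in> T_Lie"
      by (intro complex_vector.subspace_sum[OF subspace_T_Lie] T_Lie_pure[OF x])
    finally show "t \<in> T_Lie" .
  qed
qed

end
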